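(* Let $\mathcal C=\{\mu_i\}_{i\in I}$ be a (non-empty) increasing family of valuations in $\mathcal V$ admitting no last element, and let $\overline{\mathcal C}=\{\overline\mu_i\}_{i\in I}$ be an increasing family of valuations in $\overline{\mathcal V}$ with $(\overline\mu_i)_{\mid K[x]}=\mu_i$ for all $i\in I$. Write $\overline\mu_i=v_{a_i,\delta_i}$ with $(a_i,\delta_i)\in\overline K\times\Lambda$, put $B_i=B(a_i,\delta_i)$ for all $i\in I$, and let $B=\bigcap_{i\in I}B_i$. Then $\operatorname{KP}_\infty(\mathcal C)=p_K(\operatorname{Min}_K B)$.
   Context: $(K,v)$ is a valued field, $\overline K$ an algebraic closure of $K$, and $v$ also denotes a fixed extension of $v$ to $\overline K$. Put $\Gamma=v\overline K$ and fix an embedding $\Gamma\hookrightarrow\Lambda$ into a divisible (totally) ordered abelian group $\Lambda$. $\mathcal V$ is the set of all $\Lambda$-valued valuations on $K(x)$ whose restriction to $K$ is $v$, identified with valuations $\mu:K[x]\to\Lambda\cup\{\infty\}$ with $\mu^{-1}(\infty)=\{0\}$ and $\mu_{\mid K}=v$; $\overline{\mathcal V}$ is the set of $\Lambda$-valued valuations on $\overline K(x)$ whose restriction to $\overline K$ is $v$. Both are partially ordered by $\mu\le\eta$ iff $\mu(f)\le\eta(f)$ for all polynomials $f$. A family $\{\mu_i\}_{i\in I}$ is increasing if $I$ is totally ordered and $\mu_i<\mu_j$ for $i<j$. For $(a,\delta)\in\overline K\times\Lambda$: $B(a,\delta)=\{b\in\overline K\mid v(b-a)\ge\delta\}$, and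 $v_{a,\delta}\in\overline{\mathcal V}$ is given by $v_{a,\delta}\left(\sum_k a_k(x-a)^k\right)=\min_k\{v(a_k)+k\delta\}$. (For an increasing family without last element, such extensions $\overline{\mathcal C}$ exist and all $\overline\mu_i$ are of the form $v_{a_i,\delta_i}$.) For $c\in\overline K$, $p_K(c)\in K[x]$ is its minimal polynomial over $K$, and $\deg_K c=\deg p_K(c)$. For $S\subseteq\overline K$: $p_K(S)=\{p_K(c)\mid c\in S\}$; $\operatorname{Min}_K S$ is the set of $c\in S$ with $\deg_K c$ minimal among the elements of $S$ (empty if $S=\emptyset$). A polynomial $f\in K[x]$ is $\mathcal C$-stable if there is $i_0\in I$ with $\mu_i(f)=\mu_{i_0}(f)$ for all $i\ge i_0$; otherwise it is $\mathcal C$-unstable. A limit key polynomial for $\mathcal C$ is a monic $\mathcal C$-unstable polynomial of smallest degree among all $\mathcal C$-unstable polynomials. $\operatorname{KP}_\infty(\mathcal C)$ is the set of all limit key polynomials for $\mathcal C$ (empty if all polynomials are $\mathcal C$-stable). *)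

theory Defs
  imports "HOL-Library.Extended" "HOL-Computational_Algebra.Polynomial"
begin

(* Additive groups have no built-in natural multiples in HOL: the k-fold multiple of g is
   written (\<Sum>i<k. g) throughout. *)
class divisible_ordered_ab_group = linordered_ab_group_add +
  assumes divisible: "n > 0 \<Longrightarrow> \<exists>h. (\<Sum>i<(n::nat). h) = g"

(* The base field is a type of its own, embedded by emb into an algebraically closed field every
   element of which is algebraic over the image. *)
locale algebraic_closure =
  fixes emb :: "'k::field \<Rightarrow> 'a::alg_closed_field"
  assumes emb_1: "emb 1 = 1"
    and emb_add: "emb (x + y) = emb x + emb y"
    and emb_mult: "emb (x * y) = emb x * emb y"
    and emb_algebraic: "\<exists>p. p \<noteq> 0 \<and> poly (map_poly emb p) c = 0"

(* Valuations take values in the ordered group with a top element Pinf adjoined. The type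
   'l extended also has a bottom element Minf; the first condition excludes it as a value.
   Valuations on a field K(x) are represented by their restrictions to K[x], so the support
   of a valuation is {0} on polynomial rings as well. *)
definition valuation :: "('r::idom \<Rightarrow> 'l::linordered_ab_group_add extended) \<Rightarrow> bool" where
  "valuation v \<longleftrightarrow>
     (\<forall>x. x \<noteq> 0 \<longrightarrow> v x \<in> range Fin) \<and> v 0 = Pinf \<and>
     (\<forall>x y. v (x * y) = v x + v y) \<and>
     (\<forall>x y. min (v x) (v y) \<le> v (x + y))"

(* Ordered pointwise, i.e. by the order of the function type. *)
definition val_extensions ::
    "('r::field \<Rightarrow> 'l::linordered_ab_group_add extended) \<Rightarrow> ('r poly \<Rightarrow> 'l extended) set" where
  "val_extensions v = {\<mu>. valuation \<mu> \<and> (\<forall>c. \<mu> [:c:] = v c)}"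

definition val_ball ::
    "('a::field \<Rightarrow> 'l::linordered_ab_group_add extended) \<Rightarrow> 'a \<Rightarrow> 'l \<Rightarrow> 'a set" where
  "val_ball v a \<delta> = {b. Fin \<delta> \<le> v (b - a)}"

(* The coefficients of the expansion of f in powers of x - a are those of f(x + a);
   see monomial_val_expansion. *)
definition monomial_val ::
    "('a::field \<Rightarrow> 'l::linordered_ab_group_add extended) \<Rightarrow> 'a \<Rightarrow> 'l \<Rightarrow> 'a poly \<Rightarrow> 'l extended" where
  "monomial_val v a \<delta> f =
     Min ((\<lambda>k. v (coeff (pcompose f [:a, 1:]) k) + Fin (\<Sum>i<k. \<delta>)) ` {..degree f})"

definition min_poly :: "('k::field \<Rightarrow> 'a::field) \<Rightarrow> 'a \<Rightarrow> 'k poly" where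
  "min_poly emb c = (THE p. lead_coeff p = 1 \<and> poly (map_poly emb p) c = 0 \<and>
     (\<forall>q. q \<noteq> 0 \<and> poly (map_poly emb q) c = 0 \<longrightarrow> degree p \<le> degree q))"

definition alg_degree :: "('k::field \<Rightarrow> 'a::field) \<Rightarrow> 'a \<Rightarrow> nat" where
  "alg_degree emb c = degree (min_poly emb c)"

definition Min_deg :: "('k::field \<Rightarrow> 'a::field) \<Rightarrow> 'a set \<Rightarrow> 'a set" where
  "Min_deg emb S = {c \<in> S. \<forall>d \<in> S. alg_degree emb c \<le> alg_degree emb d}"

definition stable :: "'i::linorder set \<Rightarrow> ('i \<Rightarrow> 'k::field poly \<Rightarrow> 'v) \<Rightarrow> 'k poly \<Rightarrow> bool" where
  "stable I \<mu> f \<longleftrightarrow> (\<exists>i0\<in>I. \<forall>i\<in>I. i0 \<le> i \<longrightarrow> \<mu> i f = \<mu> i0 f)"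

definition KP_inf :: "'i::linorder set \<Rightarrow> ('i \<Rightarrow> 'k::field poly \<Rightarrow> 'v) \<Rightarrow> 'k poly set" where
  "KP_inf I \<mu> = {f. lead_coeff f = 1 \<and> \<not> stable I \<mu> f \<and>
     (\<forall>g. \<not> stable I \<mu> g \<longrightarrow> degree f \<le> degree g)}"

(* Any expansion may be used, also one with vanishing top coefficients. *)
lemma monomial_val_expansion:
  fixes v :: "'a::field \<Rightarrow> 'l::linordered_ab_group_add extended"
  assumes "valuation v"
  shows "monomial_val v a \<delta> (\<Sum>k\<le>n. smult (c k) ([:-a, 1:] ^ k))
       = Min ((\<lambda>k. v (c k) + Fin (\<Sum>i<k. \<delta>)) ` {..n})"
proof -
  define f where "f = (\<Sum>k\<le>n. smult (c k) ([:-a, 1:] ^ k))"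
  define g where "g = (\<lambda>k. v (coeff (pcompose f [:a, 1:]) k) + Fin (\<Sum>i<k. \<delta>))"
  have pw: "pcompose (p ^ k) q = pcompose p q ^ k" for p q :: "'a poly" and k
    by (induction k) (simp_all add: pcompose_mult pcompose_1)
  have "pcompose f [:a, 1:] = (\<Sum>k\<le>n. smult (c k) ([:0, 1:] ^ k))"
    by (simp add: f_def pcompose_sum pcompose_smult pw pcompose_pCons)
  also have "\<dots> = (\<Sum>k\<le>n. monom (c k) k)"
    by (simp add: monom_altdef)
  finally have pc: "pcompose f [:a, 1:] = (\<Sum>k\<le>n. monom (c k) k)" .
  have co: "coeff (pcompose f [:a, 1:]) k = (if k \<le> n then c k else 0)" for k
    by (simp add: pc coeff_sum)
  have v0: "v 0 = Pinf"
    using assms by (simp add: valuation_def)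
  have big: "g k = Pinf" if "k > degree f \<or> k > n" for k
  proof -
    have "coeff (pcompose f [:a, 1:]) k = 0"
    proof (cases "k \<le> n")
      case True
      then have "degree (pcompose f [:a, 1:]) < k" using that by (simp add: degree_pcompose)
      then show ?thesis by (rule coeff_eq_0)
    qed (simp add: co)
    then show ?thesis by (simp add: g_def v0)
  qed
  have ext: "Min (g ` {..m}) = Min (g ` {..N})"
    if "m \<le> N" and "\<And>k. k > m \<Longrightarrow> g k = Pinf" for m N
  proof (rule antisym)
    show "Min (g ` {..N}) \<le> Min (g ` {..m})"
      using that(1) by (intro Min_antimono image_mono) auto
    have "Min (g ` {..m}) \<le> g k" for k
    proof (cases "k \<le> m")
      case False then show ?thesis using that(2)[of k] by simp
    qed simp
    then show "Min (g ` {..m}) \<le> Min (g ` {..N})" by simp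
  qed
  have "Min (g ` {..degree f}) = Min (g ` {..max (degree f) n})"
    by (rule ext) (auto simp: big)
  also have "\<dots> = Min (g ` {..n})"
    by (rule ext[symmetric]) (auto simp: big)
  also have "g ` {..n} = (\<lambda>k. v (c k) + Fin (\<Sum>i<k. \<delta>)) ` {..n}"
    by (intro image_cong) (simp_all add: g_def co)
  finally show ?thesis by (simp add: monomial_val_def f_def g_def)
qed

context algebraic_closure
begin

lemma emb_0: "emb 0 = 0"
  using emb_add[of 0 0] by (metis add_0 add_cancel_right_right)

lemma emb_minus: "emb (- x) = - emb x"
  using emb_add[of x "- x"] by (simp add: emb_0 eq_neg_iff_add_eq_0 add.commute)

lemma map_emb_smult: "map_poly emb (smult a p) = smult (emb a) (map_poly emb p)"
  by (rule poly_eqI) (simp add: coeff_map_poly emb_0 emb_mult)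

lemma map_emb_diff: "map_poly emb (p - q) = map_poly emb p - map_poly emb q"
  by (rule poly_eqI) (use emb_add[of _ "- _"] in \<open>simp add: coeff_map_poly emb_0 emb_minus\<close>)

lemma min_poly_ex1:
  "\<exists>!p. lead_coeff p = 1 \<and> poly (map_poly emb p) c = 0 \<and>
     (\<forall>q. q \<noteq> 0 \<and> poly (map_poly emb q) c = 0 \<longrightarrow> degree p \<le> degree q)"
proof -
  let ?P = "\<lambda>p. p \<noteq> 0 \<and> poly (map_poly emb p) c = 0"
  obtain p where p: "?P p" and min: "\<And>q. ?P q \<Longrightarrow> degree p \<le> degree q"
    using ex_has_least_nat[of ?P _ degree] emb_algebraic by metis
  define r where "r = smult (inverse (lead_coeff p)) p"
  have r: "lead_coeff r = 1" "poly (map_poly emb r) c = 0" "degree r = degree p"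
    using p by (auto simp: r_def map_emb_smult)
  show ?thesis
  proof (rule ex1I[of _ r])
    fix s
    assume s: "lead_coeff s = 1 \<and> poly (map_poly emb s) c = 0 \<and>
      (\<forall>q. ?P q \<longrightarrow> degree s \<le> degree q)"
    then have "s \<noteq> 0" by auto
    with s p min have deg: "degree s = degree r" by (metis le_antisym r(3))
    show "s = r"
    proof (rule ccontr)
      assume "s \<noteq> r"
      then have "?P (s - r)" using s r by (simp add: map_emb_diff)
      then have "degree r \<le> degree (s - r)" using min r by simp
      moreover have "coeff (s - r) (degree r) = 0" using s r deg by simp
      moreover have "degree (s - r) \<le> degree r" using deg by (simp add: degree_diff_le)
      ultimately show False using \<open>s \<noteq> r\<close>
        by (metis le_antisym leading_coeff_0_iff right_minus_eq)
    qed
  qed (use r min in auto)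
qed

lemmas min_poly_props = theI'[OF min_poly_ex1, folded min_poly_def]

end

end

theory Submission
  imports Defs
begin

text \<open>
  The polynomial \<open>x - c\<close> has value \<open>min (v (a\<^sub>i - c)) \<delta>\<^sub>i\<close> at the \<open>i\<close>-th monomial valuation. The balls
  decrease strictly, so if \<open>c\<close> lies in all of them this value is the strictly increasing \<open>\<delta>\<^sub>i\<close>, and
  otherwise it is eventually constant. Splitting over the algebraic closure, a nonzero polynomial
  is therefore unstable iff it has a root in the intersection of the balls, and the unstable monic
  polynomials of least degree are the minimal polynomials of the points of least degree there.
\<close>

text \<open>A nonconstant polynomial over an algebraically closed field has a root, so splitting off
  linear factors ends at a constant. Multiplicative statements thus reduce to constants and the
  factors \<open>x - c\<close>.\<close>

lemma poly_linear_factors_induct: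
  fixes p :: "'a::alg_closed_field poly"
  assumes const: "\<And>c. P [:c:]"
    and step: "\<And>c q. P q \<Longrightarrow> P ([:-c, 1:] * q)"
  shows "P p"
proof (induction "degree p" arbitrary: p)
  case 0
  then obtain c where "p = [:c:]" by (metis degree_eq_zeroE)
  with const show ?case by simp
next
  case (Suc n)
  then obtain c where "poly p c = 0" using alg_closed_imp_poly_has_root[of p] by auto
  then obtain q where q: "p = [:-c, 1:] * q" by (auto simp: poly_eq_0_iff_dvd)
  with Suc.hyps(2) have "q \<noteq> 0" by auto
  then have "degree p = Suc (degree q)" unfolding q by (subst degree_mult_eq) auto
  then show ?case using Suc.hyps step q by simp
qed

section \<open>Ultrametric calculus and monomial valuations\<close>

context
  fixes v :: "'r::idom \<Rightarrow> 'l::linordered_ab_group_add extended"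
  assumes v: "valuation v"
begin

lemma valuation_Fin: "x \<noteq> 0 \<Longrightarrow> \<exists>y. v x = Fin y"
  and valuation_0: "v 0 = Pinf"
  and valuation_mult: "v (x * y) = v x + v y"
  and valuation_add: "min (v x) (v y) \<le> v (x + y)"
  using v unfolding valuation_def by auto

lemma valuation_1: "v 1 = 0"
proof -
  obtain t where "v 1 = Fin t" using valuation_Fin[of 1] by auto
  then show ?thesis using valuation_mult[of 1 1] by (simp add: zero_extended_def)
qed

lemma valuation_minus: "v (- x) = v x"
proof -
  obtain t where t: "v (- 1) = Fin t" using valuation_Fin[of "- 1"] by auto
  \<comment> \<open>An ordered group has no 2-torsion, so \<open>v (- 1)\<close> must
    vanish.\<close>
  have "Fin t + Fin t = 0" using valuation_mult[of "- 1" "- 1"] by (simp add: t valuation_1)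
  then have "v (- 1) = 0" by (simp add: t zero_extended_def)
  then show ?thesis using valuation_mult[of "- 1" x] by simp
qed

lemma valuation_diff_commute: "v (x - y) = v (y - x)"
  using valuation_minus[of "x - y"] by simp

lemma valuation_add_eq:
  assumes "v y < v x"
  shows "v (x + y) = v y"
proof (rule antisym)
  show "v y \<le> v (x + y)" using valuation_add[of x y] assms by simp
  \<comment> \<open>Write \<open>y\<close> as \<open>(x + y) - x\<close>; since \<open>v x\<close>
    exceeds \<open>v y\<close>, the minimum can only be \<open>v (x + y)\<close>.\<close>
  have "min (v (x + y)) (v x) \<le> v y"
    using valuation_add[of "x + y" "- x"] by (simp add: valuation_minus)
  then show "v (x + y) \<le> v y" using assms by (auto simp: min_def split: if_splits)
qed

end

text \<open>The expansion around \<open>a\<close> is \<open>(a - c) + 1 * (x - a)\<close>, and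
  \<open>v 1 = 0\<close>.\<close>

lemma monomial_val_linear:
  fixes v :: "'a::field \<Rightarrow> 'l::linordered_ab_group_add extended"
  assumes "valuation v"
  shows "monomial_val v a \<delta> [:-c, 1:] = min (v (a - c)) (Fin \<delta>)"
proof -
  have "{..Suc 0} = {0, 1}" by auto
  then show ?thesis
    using valuation_1[OF assms]
    by (simp add: monomial_val_def pcompose_pCons zero_extended_def[symmetric])
qed

text \<open>If \<open>v (a - c) < \<delta>\<close>, adding \<open>b - a\<close> does not change it;
  otherwise both values are at least \<open>\<delta>\<close> and are cut off there. Hence the
  monomial value of \<open>x - c\<close> depends on the ball and not on the chosen centre.\<close>

lemma val_ball_cong:
  assumes v: "valuation v" and b: "b \<in> val_ball v a \<delta>"
  shows "min (v (b - c)) (Fin \<delta>) = min (v (a - c)) (Fin \<delta>)"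
proof -
  have ab: "Fin \<delta> \<le> v (b - a)" using b by (simp add: val_ball_def)
  show ?thesis
  proof (cases "v (a - c) < Fin \<delta>")
    case True
    then show ?thesis using valuation_add_eq[OF v, of "a - c" "b - a"] ab by simp
  next
    case False
    then have ac: "Fin \<delta> \<le> v (a - c)" by simp
    with ab have "Fin \<delta> \<le> min (v (b - a)) (v (a - c))" by simp
    also have "\<dots> \<le> v (b - c)" using valuation_add[OF v, of "b - a" "a - c"] by simp
    finally show ?thesis using ac by (simp only: min.absorb2)
  qed
qed

section \<open>Increasing families over the algebraically closed field\<close>

locale increasing_monomial_family =
  fixes v :: "'a::alg_closed_field \<Rightarrow> 'l::linordered_ab_group_add extended"
    and I :: "'i::linorder set"
    and w :: "'i \<Rightarrow> 'a poly \<Rightarrow> 'l extended"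
    and a :: "'i \<Rightarrow> 'a" and \<delta> :: "'i \<Rightarrow> 'l"
  assumes v: "valuation v"
    and nonempty: "I \<noteq> {}"
    and no_last: "i \<in> I \<Longrightarrow> \<exists>j\<in>I. i < j"
    and w_ext: "i \<in> I \<Longrightarrow> w i \<in> val_extensions v"
    and w_mono: "strict_mono_on I w"
    and w_eq: "i \<in> I \<Longrightarrow> w i = monomial_val v (a i) (\<delta> i)"
begin

lemma w_valuation: "i \<in> I \<Longrightarrow> valuation (w i)"
  and w_const: "i \<in> I \<Longrightarrow> w i [:c:] = v c"
  using w_ext by (auto simp: val_extensions_def)

lemma w_linear: "i \<in> I \<Longrightarrow> w i [:-c, 1:] = min (v (a i - c)) (Fin (\<delta> i))"
  by (simp only: w_eq monomial_val_linear[OF v])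

lemma w_le: "w i f \<le> w j f" if "i \<in> I" "j \<in> I" "i \<le> j"
  using strict_mono_onD[OF w_mono, of i j] that
  by (cases "i = j") (auto simp: less_fun_def le_fun_def)

text \<open>Both claims come from comparing the valuations at \<open>x - a i\<close>: its value is
  \<open>\<delta> i\<close> at index \<open>i\<close> and
  \<open>min (v (a j - a i)) (\<delta> j)\<close> at index \<open>j\<close>.\<close>

lemma ball_chain:
  assumes "i \<in> I" "j \<in> I" "i \<le> j"
  shows "\<delta> i \<le> \<delta> j" and "a j \<in> val_ball v (a i) (\<delta> i)"
  using w_le[OF assms, of "[:- a i, 1:]"] valuation_0[OF v]
  by (simp_all add: w_linear[OF assms(1)] w_linear[OF assms(2)] val_ball_def)

text \<open>With equal radii the two balls coincide, so the two valuations agree on constants and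
  linear factors, hence everywhere, against strict monotonicity of \<open>w\<close>.\<close>

lemma radius_strict_mono:
  assumes "i \<in> I" "j \<in> I" "i < j"
  shows "\<delta> i < \<delta> j"
proof (rule ccontr)
  assume "\<not> \<delta> i < \<delta> j"
  then have eq: "\<delta> j = \<delta> i" using ball_chain(1)[of i j] assms by auto
  have "w i f = w j f" for f
  proof (induction f rule: poly_linear_factors_induct)
    case (1 c)
    show ?case by (simp add: w_const assms)
  next
    case (2 c q)
    have "a j \<in> val_ball v (a i) (\<delta> i)" using ball_chain(2) assms by simp
    from val_ball_cong[OF v this, of c]
    have "w i [:-c, 1:] = w j [:-c, 1:]"
      by (simp only: w_linear[OF assms(1)] w_linear[OF assms(2)] eq)
    then show ?case
      by (simp only: valuation_mult[OF w_valuation[OF assms(1)]]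
          valuation_mult[OF w_valuation[OF assms(2)]] 2)
  qed
  then have "w i = w j" by blast
  then show False using strict_mono_onD[OF w_mono assms] by simp
qed

definition core :: "'a set" where
  "core = (\<Inter>i\<in>I. val_ball v (a i) (\<delta> i))"

text \<open>Once \<open>c\<close> lies outside the ball of index \<open>i\<close>, all later centres
  are closer to \<open>a i\<close> than \<open>c\<close> is, so they have the same distance from
  \<open>c\<close>.\<close>

lemma linear_stable:
  assumes "c \<notin> core"
  shows "stable I w [:-c, 1:]"
proof -
  obtain i where i: "i \<in> I" "c \<notin> val_ball v (a i) (\<delta> i)"
    using assms by (auto simp: core_def)
  then have c: "v (a i - c) < Fin (\<delta> i)"
    by (simp add: val_ball_def valuation_diff_commute[OF v, of "a i"])
  have "w j [:-c, 1:] = w i [:-c, 1:]" if j: "j \<in> I" "i \<le> j" for j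
  proof -
    have "Fin (\<delta> i) \<le> v (a j - a i)"
      using ball_chain(2)[OF i(1) j] by (simp add: val_ball_def)
    then have "v (a j - c) = v (a i - c)"
      using valuation_add_eq[OF v, of "a i - c" "a j - a i"] c by simp
    moreover have "v (a i - c) < Fin (\<delta> j)"
      using c ball_chain(1)[OF i(1) j] by (metis less_eq_extended.simps(1) less_le_trans)
    ultimately show ?thesis using c by (simp only: w_linear[OF i(1)] w_linear[OF j(1)]) simp
  qed
  then show ?thesis unfolding stable_def using i(1) by blast
qed

lemma stable_mult:
  assumes "stable I w f" "stable I w g"
  shows "stable I w (f * g)"
proof -
  obtain i j where ij: "i \<in> I" "j \<in> I"
    and f: "\<And>k. k \<in> I \<Longrightarrow> i \<le> k \<Longrightarrow> w k f = w i f"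
    and g: "\<And>k. k \<in> I \<Longrightarrow> j \<le> k \<Longrightarrow> w k g = w j g"
    using assms unfolding stable_def by blast
  have m: "max i j \<in> I" using ij by (auto simp: max_def)
  have "w k (f * g) = w (max i j) (f * g)" if "k \<in> I" "max i j \<le> k" for k
    using that m f[of k] f[of "max i j"] g[of k] g[of "max i j"]
    by (simp add: valuation_mult[OF w_valuation])
  with m show ?thesis unfolding stable_def by blast
qed

lemma stable_const: "stable I w [:c:]"
  using nonempty by (auto simp: stable_def w_const)

text \<open>The factor \<open>x - c\<close> has value \<open>\<delta> k\<close>, which grows
  strictly, while the value of the cofactor does not decrease.\<close>

lemma root_imp_unstable:
  assumes "f \<noteq> 0" "poly f c = 0" "c \<in> core"
  shows "\<not> stable I w f"
proof
  assume "stable I w f"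
  then obtain i where i: "i \<in> I" and st: "\<And>k. k \<in> I \<Longrightarrow> i \<le> k \<Longrightarrow> w k f = w i f"
    unfolding stable_def by blast
  obtain j where j: "j \<in> I" "i < j" using no_last i by blast
  obtain q where q: "f = [:-c, 1:] * q" using assms(2) by (auto simp: poly_eq_0_iff_dvd)
  then have q0: "q \<noteq> 0" using assms(1) by auto
  have lin: "w k [:-c, 1:] = Fin (\<delta> k)" if "k \<in> I" for k
  proof -
    have "Fin (\<delta> k) \<le> v (a k - c)"
      using assms(3) that by (auto simp: core_def val_ball_def valuation_diff_commute[OF v, of "a k"])
    then show ?thesis by (simp only: w_linear[OF that] min.absorb2)
  qed
  \<comment> \<open>The cofactor is nonzero, so its values are finite and adding them preserves the
    strict inequality.\<close>
  obtain s where s: "w i q = Fin s" using valuation_Fin[OF w_valuation[OF i] q0] by auto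
  obtain t where t: "w j q = Fin t" using valuation_Fin[OF w_valuation[OF j(1)] q0] by auto
  have "s \<le> t" using w_le[of i j q] i j s t by simp
  then have "\<delta> i + s < \<delta> j + t" using radius_strict_mono[OF i j] by (simp add: add_less_le_mono)
  moreover have "w i f = Fin (\<delta> i + s)" "w j f = Fin (\<delta> j + t)"
    by (simp_all only: q valuation_mult[OF w_valuation[OF i]]
        valuation_mult[OF w_valuation[OF j(1)]] lin[OF i] lin[OF j(1)] s t plus_extended.simps)
  ultimately show False using st[of j] j by simp
qed

lemma unstable_imp_root:
  assumes "\<not> stable I w f"
  shows "\<exists>c\<in>core. poly f c = 0"
proof -
  \<comment> \<open>The contrapositive suits the induction: having no root in \<open>core\<close>
    passes to factors, and stability passes to products.\<close>
  have "(\<forall>c\<in>core. poly f c \<noteq> 0) \<longrightarrow> stable I w f"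
  proof (induction f rule: poly_linear_factors_induct)
    case (1 c)
    show ?case by (simp add: stable_const)
  next
    case (2 c q)
    show ?case
    proof
      assume nz: "\<forall>d\<in>core. poly ([:-c, 1:] * q) d \<noteq> 0"
      then have "c \<notin> core" by auto
      moreover have "stable I w q" using 2 nz by auto
      ultimately show "stable I w ([:-c, 1:] * q)" by (intro stable_mult linear_stable)
    qed
  qed
  with assms show ?thesis by blast
qed

text \<open>The zero polynomial is excluded because it vanishes on \<open>core\<close> but has the
  constant value \<open>Pinf\<close>.\<close>

lemma unstable_iff: "\<not> stable I w f \<longleftrightarrow> f \<noteq> 0 \<and> (\<exists>c\<in>core. poly f c = 0)"
  using root_imp_unstable unstable_imp_root stable_const[of 0] by auto

end

section \<open>Minimal polynomials of least degree\<close>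

context algebraic_closure
begin

text \<open>A homomorphism of fields is injective, so the leading coefficient survives.\<close>

lemma map_emb_eq_0_iff: "map_poly emb p = 0 \<longleftrightarrow> p = 0"
proof
  assume *: "map_poly emb p = 0"
  have "emb x \<noteq> 0" if "x \<noteq> 0" for x
    using that emb_mult[of x "inverse x"] emb_1 by auto
  moreover have "emb (lead_coeff p) = 0"
    using arg_cong[OF *, of "\<lambda>q. coeff q (degree p)"] by (simp add: coeff_map_poly emb_0)
  ultimately show "p = 0" by (metis leading_coeff_0_iff)
qed simp

lemma min_poly_root: "poly (map_poly emb (min_poly emb c)) c = 0"
  and min_poly_monic: "lead_coeff (min_poly emb c) = 1"
  and alg_degree_le: "q \<noteq> 0 \<Longrightarrow> poly (map_poly emb q) c = 0 \<Longrightarrow> alg_degree emb c \<le> degree q"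
  using min_poly_props[of c] by (auto simp: alg_degree_def)

lemma min_polyI:
  assumes "lead_coeff p = 1" "poly (map_poly emb p) c = 0" "degree p \<le> alg_degree emb c"
  shows "p = min_poly emb c"
  unfolding min_poly_def
  by (rule the1_equality[OF min_poly_ex1, symmetric])
    (use assms alg_degree_le[of _ c] in \<open>auto intro: order_trans\<close>)

text \<open>Minimal polynomials of points of \<open>S\<close> satisfy \<open>P\<close>, and any
  \<open>g\<close> with \<open>P g\<close> has degree at least that of one of its roots in
  \<open>S\<close>; so the least degree for \<open>P\<close> is the least \<open>alg_degree\<close>
  on \<open>S\<close>. Giving \<open>P\<close> by an equation lets instability be substituted for
  it.\<close>

lemma least_degree_with_root:
  assumes "P = (\<lambda>f. f \<noteq> 0 \<and> (\<exists>c\<in>S. poly (map_poly emb f) c = 0))"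
  shows "{f. lead_coeff f = 1 \<and> P f \<and> (\<forall>g. P g \<longrightarrow> degree f \<le> degree g)}
    = min_poly emb ` Min_deg emb S"
proof (intro set_eqI iffI)
  have P_min_poly: "P (min_poly emb c)" if "c \<in> S" for c
    using that min_poly_root[of c] min_poly_monic[of c] by (auto simp: assms)
  fix f
  {
    assume f: "f \<in> {f. lead_coeff f = 1 \<and> P f \<and> (\<forall>g. P g \<longrightarrow> degree f \<le> degree g)}"
    then obtain c where c: "c \<in> S" "poly (map_poly emb f) c = 0" "f \<noteq> 0"
      by (auto simp: assms)
    have le: "degree f \<le> alg_degree emb d" if "d \<in> S" for d
      using f P_min_poly[OF that] by (auto simp: alg_degree_def)
    have "f = min_poly emb c" using f c le by (intro min_polyI) auto
    moreover have "c \<in> Min_deg emb S"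
      using c le alg_degree_le[of f c] by (auto simp: Min_deg_def intro: order_trans)
    ultimately show "f \<in> min_poly emb ` Min_deg emb S" by blast
  next
    assume "f \<in> min_poly emb ` Min_deg emb S"
    then obtain c where f: "f = min_poly emb c" and c: "c \<in> S"
      and min: "\<And>d. d \<in> S \<Longrightarrow> alg_degree emb c \<le> alg_degree emb d"
      by (auto simp: Min_deg_def)
    have "degree f \<le> degree g" if g: "P g" for g
    proof -
      obtain d where "d \<in> S" "poly (map_poly emb g) d = 0" "g \<noteq> 0"
        using g by (auto simp: assms)
      then show ?thesis
        using min[of d] alg_degree_le[of g d] by (simp add: f alg_degree_def)
    qed
    then show "f \<in> {f. lead_coeff f = 1 \<and> P f \<and> (\<forall>g. P g \<longrightarrow> degree f \<le> degree g)}"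
      using P_min_poly[OF c] by (simp add: f min_poly_monic)
  }
qed

end

theorem theorem6p2:
  fixes emb :: "'k::field \<Rightarrow> 'a::alg_closed_field"
    and v :: "'k \<Rightarrow> 'l::divisible_ordered_ab_group extended"
    and vbar :: "'a \<Rightarrow> 'l extended"
    and I :: "'i::linorder set"
    and \<mu> :: "'i \<Rightarrow> 'k poly \<Rightarrow> 'l extended"
    and \<mu>bar :: "'i \<Rightarrow> 'a poly \<Rightarrow> 'l extended"
    and a :: "'i \<Rightarrow> 'a" and \<delta> :: "'i \<Rightarrow> 'l"
  assumes "algebraic_closure emb"
    and "valuation v" and "valuation vbar" and "\<And>c. vbar (emb c) = v c"
    and "I \<noteq> {}" and "\<And>i. i \<in> I \<Longrightarrow> \<exists>j\<in>I. i < j"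
    and "\<And>i. i \<in> I \<Longrightarrow> \<mu> i \<in> val_extensions v" and "strict_mono_on I \<mu>"
    and "\<And>i. i \<in> I \<Longrightarrow> \<mu>bar i \<in> val_extensions vbar" and "strict_mono_on I \<mu>bar"
    and "\<And>i f. i \<in> I \<Longrightarrow> \<mu>bar i (map_poly emb f) = \<mu> i f"
    and "\<And>i. i \<in> I \<Longrightarrow> \<mu>bar i = monomial_val vbar (a i) (\<delta> i)"
  shows "KP_inf I \<mu> = min_poly emb ` Min_deg emb (\<Inter>i\<in>I. val_ball vbar (a i) (\<delta> i))"
proof -
  interpret algebraic_closure emb by fact
  interpret increasing_monomial_family vbar I \<mu>bar a \<delta>
    by unfold_locales (use assms in auto)
  \<comment> \<open>Each \<open>\<mu>bar i\<close> restricts to \<open>\<mu> i\<close> along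
    \<open>map_poly emb\<close>, so the root criterion descends to the base field.\<close>
  have "stable I \<mu> f \<longleftrightarrow> stable I \<mu>bar (map_poly emb f)" for f
    using assms(11) by (auto simp: stable_def)
  then have "(\<lambda>f. \<not> stable I \<mu> f) = (\<lambda>f. f \<noteq> 0 \<and> (\<exists>c\<in>core. poly (map_poly emb f) c = 0))"
    by (simp add: unstable_iff map_emb_eq_0_iff)
  from least_degree_with_root[OF this] show ?thesis
    by (simp add: KP_inf_def core_def)
qed

end
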